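(* Let $M$ be a pointed metric space such that $(M,\mathbb{R})$ has the Lip-BPB property and let $Y$ be a Banach space having $ACK$ structure with some parameter $\rho\in[0,1)$. Then the pair $(M,Y)$ has the Lip-BPB property for Lipschitz compact maps.
   Context: All metric spaces are complete and all Banach spaces are real. $B_X$, $S_X$ are the closed unit ball and unit sphere of a Banach space $X$; $L(X,Y)$ is the space of bounded linear operators; $w^*$ is the weak-star topology. A pointed metric space is a metric space $(M,d)$ with a distinguished point $0\in M$. $\mathrm{Lip}_0(M,Y)$ is the Banach space of Lipschitz maps $F\colon M\to Y$ with $F(0)=0$, with norm $\|F\|_L=\sup\{\|F(p)-F(q)\|/d(p,q)\colon p\neq q\}$. $F\in\mathrm{Lip}_0(M,Y)$ is Lipschitz compact if $\{(F(p)-F(q))/d(p,q)\colon p\neq q\}$ is relatively compact in $Y$; $\mathrm{Lip}_{0K}(M,Y)$ is the space of such maps. The pair $(M,Y)$ has the Lip-BPB property if for every $\varepsilon>0$ there is $\eta(\varepsilon)>0$ such that for every $F\in\mathrm{Lip}_0(M,Y)$ with $\|F\|_L=1$ and all $p\neq q$ in $M$ with $\|F(p)-F(q)\|>(1-\eta(\varepsilon))d(p,q)$, there exist $G\in\mathrm{Lip}_0(M,Y)$ and $r\neq s$ in $M$ with $\frac{\|G(r)-G(s)\|}{d(r,s)}=\|G\|_L=1$, $\|G-F\|_L<\varepsilon$, $\frac{d(p,r)+d(q,s)}{d(p,q)}<\varepsilon$. It has the Lip-BPB property for Lipschitz compact maps if the same holds with $\mathrm{Lip}_{0K}(M,Y)$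 in place of $\mathrm{Lip}_0(M,Y)$ (for both $F$ and $G$). A set $\Gamma\subseteq B_{Y^*}$ is $1$-norming if $\|y\|=\sup\{|f(y)|\colon f\in\Gamma\}$ for all $y\in Y$. A Banach space $Y$ has $ACK$ structure with parameter $\rho\in[0,1)$ (written $Y\in ACK_\rho$) if there is a $1$-norming set $\Gamma\subseteq B_{Y^*}$ such that for every $\varepsilon>0$ and every nonempty relatively $w^*$-open $U\subseteq\Gamma$ there exist a nonempty $V\subseteq U$, $y_1^*\in V$, $e\in S_Y$ and $F\in L(Y,Y)$ such that: (1) $\|Fe\|=\|F\|=1$; (2) $y_1^*(Fe)=1$; (3) $F^*y_1^*=y_1^*$; (4) with $V_1=\{y^*\in\Gamma\colon\|F^*y^*\|+(1-\varepsilon)\|(\mathrm{Id}_{Y^*}-F^* )(y^* )\|\leq1\}$, one has $|v^*(Fe)|\leq\rho$ for all $v^*\in\Gamma\setminus V_1$; (5) $d(F^*y^*,\mathrm{aco}\{0,V\})<\varepsilon$ for every $y^*\in\Gamma$, where $\mathrm{aco}\{0,V\}$ is the absolutely convex hull of $\{0\}\cup V$; (6) $|v^*(e)-1|\leq\varepsilon$ for every $v^*\in V$. *)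

theory Defs
  imports "HOL-Analysis.Analysis"
begin

text \<open>
  A pointed metric space is a type of class \<^class>\<open>complete_space\<close> together with a base
  point, passed as an explicit argument (called \<open>o'\<close> below).
\<close>

definition Lip0 :: "'m::metric_space \<Rightarrow> ('m \<Rightarrow> 'y::real_normed_vector) set" where
  "Lip0 o' = {F. F o' = 0 \<and> (\<exists>L. L-lipschitz_on UNIV F)}"

text \<open>Inserting \<open>0\<close> into a set of nonnegative reals only makes the supremum over the
  empty set equal to \<open>0\<close> (here: when the metric space is a single point).\<close>

definition lip_norm :: "('m::metric_space \<Rightarrow> 'y::real_normed_vector) \<Rightarrow> real" where
  "lip_norm F = Sup (insert 0 {norm (F p - F q) / dist p q |p q. p \<noteq> q})"

definition lipschitz_compact :: "('m::metric_space \<Rightarrow> 'y::real_normed_vector) \<Rightarrow> bool" where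
  "lipschitz_compact F \<longleftrightarrow>
     compact (closure {(F p - F q) /\<^sub>R dist p q |p q. p \<noteq> q})"

definition Lip0K :: "'m::metric_space \<Rightarrow> ('m \<Rightarrow> 'y::real_normed_vector) set" where
  "Lip0K o' = {F \<in> Lip0 o'. lipschitz_compact F}"

text \<open>The approximation property relative to a class \<open>\<A>\<close> of maps, from which both the
  given and the approximating map are taken.\<close>

definition Lip_BPB_for :: "('m::metric_space \<Rightarrow> 'y::real_normed_vector) set \<Rightarrow> bool" where
  "Lip_BPB_for \<A> \<longleftrightarrow>
     (\<forall>\<epsilon>>0. \<exists>\<eta>>0. \<forall>F\<in>\<A>. \<forall>p q.
        lip_norm F = 1 \<and> p \<noteq> q \<and> norm (F p - F q) > (1 - \<eta>) * dist p q \<longrightarrow>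
        (\<exists>G\<in>\<A>. \<exists>r s. r \<noteq> s \<and>
           norm (G r - G s) / dist r s = lip_norm G \<and> lip_norm G = 1 \<and>
           lip_norm (\<lambda>x. G x - F x) < \<epsilon> \<and>
           (dist p r + dist q s) / dist p q < \<epsilon>))"

definition Lip_BPB :: "'m::complete_space \<Rightarrow> 'y::banach itself \<Rightarrow> bool" where
  "Lip_BPB o' TYPE('y) \<longleftrightarrow> Lip_BPB_for (Lip0 o' :: ('m \<Rightarrow> 'y) set)"

definition Lip_BPB_compact :: "'m::complete_space \<Rightarrow> 'y::banach itself \<Rightarrow> bool" where
  "Lip_BPB_compact o' TYPE('y) \<longleftrightarrow> Lip_BPB_for (Lip0K o' :: ('m \<Rightarrow> 'y) set)"

text \<open>For real-valued functionals the strong operator topology is the topology of pointwise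
  convergence, i.e. the weak-star topology of the dual.\<close>

abbreviation weak_star :: "('y::real_normed_vector \<Rightarrow>\<^sub>L real) topology" where
  "weak_star \<equiv> strong_operator_topology"

definition one_norming :: "('y::real_normed_vector \<Rightarrow>\<^sub>L real) set \<Rightarrow> bool" where
  "one_norming \<Gamma> \<longleftrightarrow> \<Gamma> \<subseteq> cball 0 1 \<and>
     (\<forall>y. norm y = Sup (insert 0 {\<bar>blinfun_apply f y\<bar> |f. f \<in> \<Gamma>}))"

definition absolutely_convex :: "'a::real_vector set \<Rightarrow> bool" where
  "absolutely_convex S \<longleftrightarrow>
     (\<forall>x\<in>S. \<forall>y\<in>S. \<forall>a b. \<bar>a\<bar> + \<bar>b\<bar> \<le> 1 \<longrightarrow> a *\<^sub>R x + b *\<^sub>R y \<in> S)"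

definition aco :: "'a::real_vector set \<Rightarrow> 'a set" where
  "aco S = absolutely_convex hull S"

definition adjoint_blinfun ::
  "('y::real_normed_vector \<Rightarrow>\<^sub>L 'z::real_normed_vector) \<Rightarrow> ('z \<Rightarrow>\<^sub>L real) \<Rightarrow> ('y \<Rightarrow>\<^sub>L real)" where
  "adjoint_blinfun F f = f o\<^sub>L F"

definition ACK :: "'y::banach itself \<Rightarrow> real \<Rightarrow> bool" where
  "ACK TYPE('y) \<rho> \<longleftrightarrow>
     (\<exists>\<Gamma> :: ('y \<Rightarrow>\<^sub>L real) set. one_norming \<Gamma> \<and>
       (\<forall>\<epsilon>>0. \<forall>U. openin (subtopology weak_star \<Gamma>) U \<and> U \<noteq> {} \<longrightarrow>
         (\<exists>V y1 e. \<exists>F :: 'y \<Rightarrow>\<^sub>L 'y. V \<noteq> {} \<and> V \<subseteq> U \<and> y1 \<in> V \<and> e \<in> sphere 0 1 \<and>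
           norm (blinfun_apply F e) = 1 \<and> norm F = 1 \<and>
           blinfun_apply y1 (blinfun_apply F e) = 1 \<and>
           adjoint_blinfun F y1 = y1 \<and>
           (let V1 = {y \<in> \<Gamma>. norm (adjoint_blinfun F y)
                        + (1 - \<epsilon>) * norm (y - adjoint_blinfun F y) \<le> 1}
            in \<forall>v\<in>\<Gamma> - V1. \<bar>blinfun_apply v (blinfun_apply F e)\<bar> \<le> \<rho>) \<and>
           (\<forall>y\<in>\<Gamma>. infdist (adjoint_blinfun F y) (aco (insert 0 V)) < \<epsilon>) \<and>
           (\<forall>v\<in>V. \<bar>blinfun_apply v e - 1\<bar> \<le> \<epsilon>))))"

end

theory Submission
  imports Defs
begin

text \<open>
  Compactness of the slopes of \<open>F\<close> makes \<open>y\<^sup>* \<mapsto> y\<^sup>* \<circ> F\<close> weak-star-to-norm continuous on \<open>\<Gamma>\<close>,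
  so a functional \<open>y\<^sub>0\<^sup>* \<in> \<Gamma>\<close> that almost norms \<open>F p - F q\<close> has a weak-star neighbourhood \<open>U\<close> on
  which all \<open>y\<^sup>* \<circ> F\<close> nearly agree. The \<open>ACK\<close> structure yields \<open>V \<subseteq> U\<close>, \<open>y\<^sub>1\<^sup>*\<close>, \<open>e\<close> and an operator
  \<open>\<Phi>\<close>; the scalar property applied to the normalised \<open>y\<^sub>1\<^sup>* \<circ> F\<close> yields \<open>g\<close> attaining its norm at
  \<open>(r, s)\<close>. As \<open>\<Phi>\<^sup>*\<close> maps \<open>\<Gamma>\<close> close to the absolutely convex hull of \<open>V\<close>, where
  \<open>v\<^sup>* \<circ> F \<approx> g\<close> and \<open>v\<^sup>*(e) \<approx> 1\<close>, the maps \<open>\<Phi> \<circ> F\<close> and \<open>g \<cdot> \<Phi> e\<close> are close in Lipschitz norm.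
  Hence \<open>G = g \<cdot> \<Phi> e + (1 - \<tau>) (F - \<Phi> \<circ> F)\<close> is close to \<open>F\<close>; it attains its norm at \<open>(r, s)\<close>
  because \<open>y\<^sub>1\<^sup>* \<circ> G = g\<close>, and testing against \<open>\<Gamma>\<close>, separately inside and outside \<open>V\<^sub>1\<close>, shows
  that its Lipschitz norm is at most \<open>1\<close>.
\<close>

section \<open>Difference quotients and the Lipschitz norm\<close>

text \<open>Difference quotients are linear in the map and commute with bounded operators, so
  estimates on Lipschitz maps reduce to estimates on single vectors.\<close>

definition slope :: "('m::metric_space \<Rightarrow> 'y::real_normed_vector) \<Rightarrow> 'm \<Rightarrow> 'm \<Rightarrow> 'y" where
  "slope F p q = (F p - F q) /\<^sub>R dist p q"

lemma norm_slope: "norm (slope F p q) = norm (F p - F q) / dist p q"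
  by (simp add: slope_def divide_inverse mult.commute)

lemma slope_diff: "slope (\<lambda>x. F x - G x) p q = slope F p q - slope G p q"
  by (simp add: slope_def algebra_simps)

lemma slope_add: "slope (\<lambda>x. F x + G x) p q = slope F p q + slope G p q"
  by (simp add: slope_def algebra_simps)

lemma slope_bounded_linear:
  assumes "bounded_linear T"
  shows "slope (\<lambda>x. T (F x)) p q = T (slope F p q)"
proof -
  interpret bounded_linear T by fact
  show ?thesis by (simp add: slope_def scaleR diff)
qed

lemma lip_norm_slope: "lip_norm F = Sup (insert 0 {norm (slope F p q) |p q. p \<noteq> q})"
  by (simp add: lip_norm_def norm_slope)

lemma lip_norm_le:
  assumes "0 \<le> c" "\<And>p q. p \<noteq> q \<Longrightarrow> norm (slope F p q) \<le> c"
  shows "lip_norm F \<le> c"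
  unfolding lip_norm_slope by (rule cSup_least) (use assms in auto)

text \<open>Membership in \<open>Lip0\<close> supplies a Lipschitz constant bounding the set of
  slopes; a real supremum dominates its elements only for such bounded sets.\<close>

lemma Lip0_norm_slope_le:
  assumes "F \<in> Lip0 o'" "p \<noteq> q"
  shows "norm (slope F p q) \<le> lip_norm F"
proof -
  obtain L where L: "L-lipschitz_on UNIV F" using assms(1) by (auto simp: Lip0_def)
  then have "norm (slope F a b) \<le> L" if "a \<noteq> b" for a b
    using that lipschitz_onD[OF L, of a b] by (simp add: norm_slope dist_norm divide_le_eq)
  moreover have "0 \<le> L" using L by (rule lipschitz_on_nonneg)
  ultimately have "bdd_above (insert 0 {norm (slope F p q) |p q. p \<noteq> q})"
    by (intro bdd_aboveI[of _ L]) auto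
  then show ?thesis
    unfolding lip_norm_slope by (rule cSup_upper[rotated]) (use assms in auto)
qed

lemma Lip0I:
  assumes "F o' = 0" "\<And>p q. p \<noteq> q \<Longrightarrow> norm (slope F p q) \<le> L" "0 \<le> L"
  shows "F \<in> Lip0 o'"
proof -
  have "dist (F p) (F q) \<le> L * dist p q" for p q
    using assms(2)[of p q] by (cases "p = q") (auto simp: norm_slope dist_norm divide_le_eq)
  then have "L-lipschitz_on UNIV F" using assms(3) by (intro lipschitz_onI)
  then show ?thesis using assms(1) by (auto simp: Lip0_def)
qed

lemma Lip0_bounded_linear:
  fixes F :: "'m::metric_space \<Rightarrow> 'y::real_normed_vector"
  assumes "bounded_linear T" "F \<in> Lip0 o'"
  shows "(\<lambda>x. T (F x)) \<in> Lip0 o'"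
proof (rule Lip0I)
  interpret bounded_linear T by fact
  show "T (F o') = 0" using assms(2) by (simp add: Lip0_def zero)
  fix p q :: 'm assume pq: "p \<noteq> q"
  have "norm (T (slope F p q)) \<le> onorm T * norm (slope F p q)"
    by (rule onorm[OF assms(1)])
  also have "\<dots> \<le> onorm T * \<bar>lip_norm F\<bar>"
    using Lip0_norm_slope_le[OF assms(2) pq] onorm_pos_le[OF assms(1)]
    by (intro mult_left_mono) auto
  finally show "norm (slope (\<lambda>x. T (F x)) p q) \<le> onorm T * \<bar>lip_norm F\<bar>"
    by (simp add: slope_bounded_linear[OF assms(1)])
qed (use onorm_pos_le[OF assms(1)] in simp)

text \<open>The scalar approximation property speaks of maps of norm exactly 1; this allows a
  functional composed with \<open>F\<close> to be normalised before applying it.\<close>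

lemma lip_norm_inverse_scaleR:
  fixes F :: "'m::metric_space \<Rightarrow> 'y::real_normed_vector"
  assumes "F \<in> Lip0 o'" "0 < lip_norm F"
  shows "lip_norm (\<lambda>x. F x /\<^sub>R lip_norm F) = 1"
proof -
  define L where "L = lip_norm F"
  define H where "H = (\<lambda>x. F x /\<^sub>R L)"
  have L: "0 < L" using assms(2) by (simp add: L_def)
  have H: "H \<in> Lip0 o'"
    unfolding H_def by (rule Lip0_bounded_linear[OF bounded_linear_scaleR_right assms(1)])
  have "slope H p q = slope F p q /\<^sub>R L" for p q
    unfolding H_def by (rule slope_bounded_linear[OF bounded_linear_scaleR_right])
  then have sl: "norm (slope F p q) = L * norm (slope H p q)" for p q
    using L by simp
  have "lip_norm H \<le> 1"
  proof (rule lip_norm_le)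
    show "norm (slope H p q) \<le> 1" if "p \<noteq> q" for p q
      using Lip0_norm_slope_le[OF assms(1) that] L by (simp add: sl flip: L_def)
  qed simp
  moreover have "L \<le> L * lip_norm H"
    unfolding L_def
  proof (rule lip_norm_le, fold L_def)
    \<comment> \<open>Positivity of \<open>lip_norm F\<close> forces two distinct points, and a
      slope between them shows that \<open>lip_norm H\<close> is nonnegative.\<close>
    obtain p q :: 'm where "p \<noteq> q"
      using assms(2) lip_norm_le[of 0 F] by force
    then have "0 \<le> lip_norm H"
      using Lip0_norm_slope_le[OF H] norm_ge_zero order_trans by blast
    then show "0 \<le> L * lip_norm H" using L by simp
    show "norm (slope F p q) \<le> L * lip_norm H" if "p \<noteq> q" for p q
      using Lip0_norm_slope_le[OF H that] L by (simp add: sl)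
  qed
  ultimately have "lip_norm H = 1" using L by simp
  then show ?thesis by (simp add: H_def L_def)
qed

section \<open>Norming sets, absolutely convex hulls and weak-star neighbourhoods\<close>

lemma one_norming_norm_le:
  assumes "one_norming \<Gamma>" "0 \<le> c" "\<And>v. v \<in> \<Gamma> \<Longrightarrow> \<bar>blinfun_apply v y\<bar> \<le> c"
  shows "norm y \<le> c"
proof -
  have "norm y = Sup (insert 0 {\<bar>blinfun_apply f y\<bar> |f. f \<in> \<Gamma>})"
    using assms(1) by (simp add: one_norming_def)
  also have "\<dots> \<le> c" by (rule cSup_least) (use assms in auto)
  finally show ?thesis .
qed

lemma one_norming_apply_le:
  assumes "one_norming \<Gamma>" "v \<in> \<Gamma>"
  shows "\<bar>blinfun_apply v y\<bar> \<le> norm y"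
proof -
  have "norm v \<le> 1" using assms by (auto simp: one_norming_def)
  then have "norm v * norm y \<le> norm y" by (simp add: mult_left_le_one_le)
  then show ?thesis using norm_blinfun[of v y] by simp
qed

text \<open>The functionals bounded by \<open>c\<close> at \<open>z\<close> form an absolutely
  convex set, so the bound passes from \<open>V\<close> to the hull.\<close>

lemma aco_apply_le:
  fixes V :: "('y::real_normed_vector \<Rightarrow>\<^sub>L real) set"
  assumes "0 \<le> c" "\<And>v. v \<in> V \<Longrightarrow> \<bar>blinfun_apply v z\<bar> \<le> c" "w \<in> aco (insert 0 V)"
  shows "\<bar>blinfun_apply w z\<bar> \<le> c"
proof -
  have "absolutely_convex {w. \<bar>blinfun_apply w z\<bar> \<le> c}"
    unfolding absolutely_convex_def
  proof (intro ballI allI impI CollectI)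
    fix x y :: "'y \<Rightarrow>\<^sub>L real" and a b :: real
    assume xy: "x \<in> {w. \<bar>blinfun_apply w z\<bar> \<le> c}" "y \<in> {w. \<bar>blinfun_apply w z\<bar> \<le> c}"
      and ab: "\<bar>a\<bar> + \<bar>b\<bar> \<le> 1"
    have "\<bar>blinfun_apply (a *\<^sub>R x + b *\<^sub>R y) z\<bar> \<le> \<bar>a\<bar> * \<bar>blinfun_apply x z\<bar> + \<bar>b\<bar> * \<bar>blinfun_apply y z\<bar>"
      by (simp add: blinfun.bilinear_simps abs_mult[symmetric])
    also have "\<dots> \<le> \<bar>a\<bar> * c + \<bar>b\<bar> * c"
      using xy by (intro add_mono mult_left_mono) auto
    also have "\<dots> \<le> 1 * c" unfolding distrib_right[symmetric]
      by (rule mult_right_mono[OF ab assms(1)])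
    finally show "\<bar>blinfun_apply (a *\<^sub>R x + b *\<^sub>R y) z\<bar> \<le> c" by simp
  qed
  then have "aco (insert 0 V) \<subseteq> {w. \<bar>blinfun_apply w z\<bar> \<le> c}"
    unfolding aco_def using assms by (intro hull_minimal) auto
  then show ?thesis using assms(3) by auto
qed

text \<open>Nonemptiness matters: \<open>infdist\<close> to the empty set is 0 by
  convention.\<close>

lemma infdist_lessE:
  assumes "infdist x A < r" "A \<noteq> {}"
  obtains a where "a \<in> A" "dist x a < r"
proof -
  have "\<exists>a\<in>A. dist x a < r"
    using assms by (auto simp: infdist_def dest: cInf_lessD[rotated])
  then show ?thesis using that by blast
qed

text \<open>Pointwise closeness at a finite \<open>\<mu>/3\<close>-net of \<open>K\<close> becomes
  uniform on \<open>K\<close>, because functionals in \<open>\<Gamma>\<close> have norm at most 1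
  and so change by less than \<open>\<mu>/3\<close> between a point and a nearby net point.\<close>

lemma weak_star_neighbourhood_compact:
  fixes \<Gamma> :: "('y::real_normed_vector \<Rightarrow>\<^sub>L real) set"
  assumes \<Gamma>: "one_norming \<Gamma>" and f0: "f0 \<in> \<Gamma>" and K: "compact K" and \<mu>: "0 < \<mu>"
  obtains U where "openin (subtopology weak_star \<Gamma>) U" "f0 \<in> U"
    "\<And>v k. v \<in> U \<Longrightarrow> k \<in> K \<Longrightarrow> \<bar>blinfun_apply v k - blinfun_apply f0 k\<bar> < \<mu>"
proof -
  have "\<forall>e>0. \<exists>k. finite k \<and> K \<subseteq> (\<Union>x\<in>k. ball x e)"
    using K by (simp add: compact_eq_totally_bounded)
  then obtain N where N: "finite N" "K \<subseteq> (\<Union>x\<in>N. ball x (\<mu>/3))"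
    using \<mu> by (meson zero_less_divide_iff zero_less_numeral)
  define W where "W = (\<Inter>n\<in>N. {v \<in> topspace weak_star. blinfun_apply v n \<in> ball (blinfun_apply f0 n) (\<mu>/3)}) \<inter> topspace weak_star"
  have "openin weak_star {v \<in> topspace weak_star. blinfun_apply v n \<in> ball (blinfun_apply f0 n) (\<mu>/3)}" for n
    by (rule openin_continuous_map_preimage[OF strong_operator_topology_continuous_evaluation]) simp
  then have W: "openin weak_star W"
    unfolding W_def using N(1) by (cases "N = {}") (auto intro!: openin_Int openin_INT)
  show ?thesis
  proof (rule that[of "\<Gamma> \<inter> W"])
    show "openin (subtopology weak_star \<Gamma>) (\<Gamma> \<inter> W)"
      using W by (rule openin_subtopology_Int2)
    show "f0 \<in> \<Gamma> \<inter> W" using f0 \<mu> by (simp add: W_def strong_operator_topology_topspace)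
    fix v k assume v: "v \<in> \<Gamma> \<inter> W" and "k \<in> K"
    then obtain n where n: "n \<in> N" "dist n k < \<mu>/3" using N(2) by auto
    have "\<bar>blinfun_apply v n - blinfun_apply f0 n\<bar> < \<mu>/3"
      using v n(1) by (auto simp: W_def dist_real_def abs_minus_commute)
    moreover have "\<bar>blinfun_apply f (n - k)\<bar> < \<mu>/3" if "f \<in> \<Gamma>" for f
      using one_norming_apply_le[OF \<Gamma> that, of "n - k"] n(2) by (simp add: dist_norm)
    from this[of v] this[OF f0] have "\<bar>blinfun_apply v n - blinfun_apply v k\<bar> < \<mu>/3"
      "\<bar>blinfun_apply f0 n - blinfun_apply f0 k\<bar> < \<mu>/3"
      using v by (auto simp: blinfun.diff_right)
    ultimately show "\<bar>blinfun_apply v k - blinfun_apply f0 k\<bar> < \<mu>" by linarith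
  qed
qed

section \<open>Two estimates from the ACK structure\<close>

text \<open>The value in question is that of \<open>adjoint_blinfun \<Phi> v\<close> at
  \<open>k - \<gamma> *\<^sub>R e\<close>. Replacing this functional by a nearby \<open>w\<close> in
  the hull costs \<open>2 * a\<close>, as the vector has norm at most 2; the value of
  \<open>w\<close> is at most \<open>b + a\<close>, since this holds on \<open>V\<close>.\<close>

lemma abs_apply_diff_le_infdist_aco:
  fixes k e :: "'y::real_normed_vector" and \<Phi> :: "'y \<Rightarrow>\<^sub>L 'y"
  assumes a: "0 \<le> a" "0 \<le> b" and e: "norm e = 1" and k: "norm k \<le> 1" and \<gamma>: "\<bar>\<gamma>\<bar> \<le> 1"
    and V: "\<And>v. v \<in> V \<Longrightarrow> \<bar>blinfun_apply v k - \<gamma>\<bar> \<le> b" "\<And>v. v \<in> V \<Longrightarrow> \<bar>blinfun_apply v e - 1\<bar> \<le> a"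
    and v: "infdist (adjoint_blinfun \<Phi> v) (aco (insert 0 V)) < a"
  shows "\<bar>blinfun_apply v (blinfun_apply \<Phi> k - \<gamma> *\<^sub>R blinfun_apply \<Phi> e)\<bar> \<le> b + 3 * a"
proof -
  let ?z = "k - \<gamma> *\<^sub>R e"
  have "0 \<in> aco (insert 0 V)" unfolding aco_def by (rule hull_inc) simp
  then obtain w where w: "w \<in> aco (insert 0 V)" "dist (adjoint_blinfun \<Phi> v) w < a"
    using infdist_lessE[OF v] by blast
  have "\<bar>blinfun_apply w ?z\<bar> \<le> b + a"
  proof (rule aco_apply_le[OF _ _ w(1)])
    fix u assume u: "u \<in> V"
    have "\<bar>\<gamma> * (blinfun_apply u e - 1)\<bar> \<le> 1 * a"
      unfolding abs_mult by (rule mult_mono) (use \<gamma> V(2)[OF u] in auto)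
    moreover have "blinfun_apply u ?z = (blinfun_apply u k - \<gamma>) - \<gamma> * (blinfun_apply u e - 1)"
      by (simp add: blinfun.bilinear_simps algebra_simps)
    ultimately show "\<bar>blinfun_apply u ?z\<bar> \<le> b + a" using V(1)[OF u] by linarith
  qed (use a in simp)
  moreover have "\<bar>blinfun_apply (adjoint_blinfun \<Phi> v - w) ?z\<bar> \<le> 2 * a"
  proof -
    have "norm ?z \<le> 2"
      using norm_triangle_ineq4[of k "\<gamma> *\<^sub>R e"] e k \<gamma> by simp
    then have "norm (adjoint_blinfun \<Phi> v - w) * norm ?z \<le> a * 2"
      using w(2) a by (intro mult_mono) (auto simp: dist_norm)
    then show ?thesis using norm_blinfun[of "adjoint_blinfun \<Phi> v - w" ?z] by simp
  qed
  ultimately have "\<bar>blinfun_apply (adjoint_blinfun \<Phi> v) ?z\<bar> \<le> b + 3 * a"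
    by (simp add: blinfun.diff_left)
  then show ?thesis by (simp add: adjoint_blinfun_def blinfun.bilinear_simps)
qed

text \<open>Bounds a slope of the approximating map, with \<open>k\<close> a slope of
  \<open>F\<close> and \<open>\<gamma>\<close> one of \<open>g\<close>. Functionals in
  \<open>\<Gamma>\<close> are split by whether their value at \<open>\<Phi> e\<close> exceeds
  \<open>\<rho>\<close> in modulus; if it does, they lie in the set \<open>V1\<close> of the ACK
  structure.\<close>

lemma norm_ACK_combination_le:
  fixes k e :: "'y::real_normed_vector" and \<Phi> :: "'y \<Rightarrow>\<^sub>L 'y"
  assumes \<Gamma>: "one_norming \<Gamma>" and \<rho>: "0 \<le> \<rho>" "\<rho> < 1" and \<tau>: "\<alpha> \<le> \<tau>" "0 < \<tau>" "\<tau> \<le> 1"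
    and e: "norm e = 1" and k: "norm k \<le> 1" and \<gamma>: "\<bar>\<gamma>\<bar> \<le> 1"
    and V1: "\<And>v. v \<in> \<Gamma> \<Longrightarrow> \<rho> < \<bar>blinfun_apply v (blinfun_apply \<Phi> e)\<bar> \<Longrightarrow>
          norm (adjoint_blinfun \<Phi> v) + (1 - \<alpha>) * norm (v - adjoint_blinfun \<Phi> v) \<le> 1"
    and close: "norm (blinfun_apply \<Phi> k - \<gamma> *\<^sub>R blinfun_apply \<Phi> e) \<le> \<tau> * (1 - \<rho>)"
  shows "norm (\<gamma> *\<^sub>R blinfun_apply \<Phi> e + (1 - \<tau>) *\<^sub>R (k - blinfun_apply \<Phi> k)) \<le> 1"
    (is "norm ?x \<le> 1")
proof (rule one_norming_norm_le[OF \<Gamma>])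
  fix v assume v: "v \<in> \<Gamma>"
  let ?s = "blinfun_apply v (blinfun_apply \<Phi> e)"
  show "\<bar>blinfun_apply v ?x\<bar> \<le> 1"
  proof (cases "\<rho> < \<bar>?s\<bar>")
    case True
    \<comment> \<open>Regrouping produces the two norms in the definition of \<open>V1\<close>;
      \<open>\<alpha> \<le> \<tau>\<close> lets the factor \<open>1 - \<tau>\<close> be replaced by
      \<open>1 - \<alpha>\<close>.\<close>
    have "blinfun_apply v ?x = \<gamma> * blinfun_apply (adjoint_blinfun \<Phi> v) e
        + (1 - \<tau>) * blinfun_apply (v - adjoint_blinfun \<Phi> v) k"
      by (simp add: adjoint_blinfun_def blinfun.bilinear_simps)
    also have "\<bar>\<dots>\<bar> \<le> \<bar>\<gamma>\<bar> * \<bar>blinfun_apply (adjoint_blinfun \<Phi> v) e\<bar>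
        + (1 - \<tau>) * \<bar>blinfun_apply (v - adjoint_blinfun \<Phi> v) k\<bar>"
      by (rule order_trans[OF abs_triangle_ineq]) (use \<tau> in \<open>simp add: abs_mult\<close>)
    also have "\<dots> \<le> 1 * norm (adjoint_blinfun \<Phi> v) + (1 - \<alpha>) * norm (v - adjoint_blinfun \<Phi> v)"
    proof (intro add_mono mult_mono)
      show "\<bar>blinfun_apply (adjoint_blinfun \<Phi> v) e\<bar> \<le> norm (adjoint_blinfun \<Phi> v)"
        using norm_blinfun[of "adjoint_blinfun \<Phi> v" e] e by simp
      have "norm (v - adjoint_blinfun \<Phi> v) * norm k \<le> norm (v - adjoint_blinfun \<Phi> v)"
        using k by (simp add: mult_left_le)
      then show "\<bar>blinfun_apply (v - adjoint_blinfun \<Phi> v) k\<bar> \<le> norm (v - adjoint_blinfun \<Phi> v)"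
        using norm_blinfun[of "v - adjoint_blinfun \<Phi> v" k] by simp
    qed (use \<tau> \<gamma> in auto)
    also have "\<dots> \<le> 1" using V1[OF v True] by simp
    finally show ?thesis .
  next
    case False
    \<comment> \<open>Substituting \<open>\<gamma> * ?s + ?d\<close> for the value at
      \<open>\<Phi> k\<close> leaves only the fraction \<open>\<tau>\<close> of
      \<open>\<gamma> * ?s\<close>. As this is at most \<open>\<tau> * \<rho>\<close>, there is room
      \<open>\<tau> * (1 - \<rho>)\<close> for the error \<open>?d\<close>.\<close>
    let ?d = "blinfun_apply v (blinfun_apply \<Phi> k - \<gamma> *\<^sub>R blinfun_apply \<Phi> e)"
    have "\<bar>\<gamma>\<bar> * \<bar>?s\<bar> \<le> 1 * \<rho>" by (rule mult_mono) (use False \<gamma> in auto)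
    then have gs: "\<bar>\<tau> * (\<gamma> * ?s)\<bar> \<le> \<tau> * \<rho>" using \<tau> by (simp add: abs_mult)
    have "\<bar>?d\<bar> \<le> \<tau> * (1 - \<rho>)" using one_norming_apply_le[OF \<Gamma> v] close by (rule order_trans)
    moreover have "\<bar>blinfun_apply v k\<bar> \<le> 1" using one_norming_apply_le[OF \<Gamma> v] k by (rule order_trans)
    ultimately have "\<bar>(1 - \<tau>) * (blinfun_apply v k - ?d)\<bar> \<le> (1 - \<tau>) * (1 + \<tau> * (1 - \<rho>))"
      unfolding abs_mult using \<tau> by (intro mult_mono) auto
    also have "\<dots> \<le> 1 - \<tau> + \<tau> * (1 - \<rho>)"
    proof -
      have "0 \<le> \<tau> * (\<tau> * (1 - \<rho>))" using \<tau> \<rho> by simp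
      then show ?thesis by (simp add: algebra_simps)
    qed
    finally have "\<bar>(1 - \<tau>) * (blinfun_apply v k - ?d)\<bar> + \<bar>\<tau> * (\<gamma> * ?s)\<bar> \<le> 1"
      using gs by (simp add: algebra_simps)
    moreover have "blinfun_apply v ?x = (1 - \<tau>) * (blinfun_apply v k - ?d) + \<tau> * (\<gamma> * ?s)"
      by (simp add: blinfun.bilinear_simps algebra_simps)
    ultimately show ?thesis by linarith
  qed
qed simp

section \<open>The approximation property for Lipschitz compact maps\<close>

lemma Lip_BPB_for_slope:
  "Lip_BPB_for \<A> \<longleftrightarrow> (\<forall>\<epsilon>>0. \<exists>\<eta>>0. \<forall>F\<in>\<A>. \<forall>p q.
      lip_norm F = 1 \<and> p \<noteq> q \<and> 1 - \<eta> < norm (slope F p q) \<longrightarrow>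
      (\<exists>G\<in>\<A>. \<exists>r s. r \<noteq> s \<and> norm (slope G r s) = lip_norm G \<and> lip_norm G = 1 \<and>
        lip_norm (\<lambda>x. G x - F x) < \<epsilon> \<and> (dist p r + dist q s) / dist p q < \<epsilon>))"
proof -
  have "(p \<noteq> q \<and> (1 - \<eta>) * dist p q < norm (F p - F q)) \<longleftrightarrow> (p \<noteq> q \<and> 1 - \<eta> < norm (slope F p q))"
    for F :: "'a \<Rightarrow> 'b" and p q \<eta>
    by (auto simp: norm_slope less_divide_eq)
  then show ?thesis unfolding Lip_BPB_for_def by (simp only: norm_slope)
qed

theorem proposition3p12:
  fixes o' :: "'m::complete_space" and \<rho> :: real
  assumes "Lip_BPB o' TYPE(real)"
    and "0 \<le> \<rho>" and "\<rho> < 1"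
    and "ACK TYPE('y::banach) \<rho>"
  shows "Lip_BPB_compact o' TYPE('y)"
  unfolding Lip_BPB_compact_def
  Lip_BPB_for_slope
proof (intro allI impI)
  fix \<epsilon> :: real assume \<epsilon>: "0 < \<epsilon>"
  obtain \<Gamma> :: "('y \<Rightarrow>\<^sub>L real) set" where \<Gamma>: "one_norming \<Gamma>" and
    ack: "\<forall>\<alpha>>0. \<forall>U. openin (subtopology weak_star \<Gamma>) U \<and> U \<noteq> {} \<longrightarrow>
        (\<exists>V y1 e. \<exists>F :: 'y \<Rightarrow>\<^sub>L 'y. V \<noteq> {} \<and> V \<subseteq> U \<and> y1 \<in> V \<and> e \<in> sphere 0 1 \<and>
           norm (blinfun_apply F e) = 1 \<and> norm F = 1 \<and>
           blinfun_apply y1 (blinfun_apply F e) = 1 \<and>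
           adjoint_blinfun F y1 = y1 \<and>
           (let V1 = {y \<in> \<Gamma>. norm (adjoint_blinfun F y)
                        + (1 - \<alpha>) * norm (y - adjoint_blinfun F y) \<le> 1}
            in \<forall>v\<in>\<Gamma> - V1. \<bar>blinfun_apply v (blinfun_apply F e)\<bar> \<le> \<rho>) \<and>
           (\<forall>y\<in>\<Gamma>. infdist (adjoint_blinfun F y) (aco (insert 0 V)) < \<alpha>) \<and>
           (\<forall>v\<in>V. \<bar>blinfun_apply v e - 1\<bar> \<le> \<alpha>))"
    using assms(4) unfolding ACK_def by - (erule exE, erule conjE, erule (1) that)
  \<comment> \<open>The final map will be within \<open>3 * \<tau>\<close> of \<open>F\<close>; the
    cap at 1 keeps \<open>1 - \<tau>\<close> nonnegative.\<close>
  define \<tau> where "\<tau> = min (\<epsilon>/4) 1"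
  have \<tau>: "0 < \<tau>" "\<tau> \<le> 1" "3 * \<tau> < \<epsilon>" using \<epsilon> by (auto simp: \<tau>_def)
  \<comment> \<open>The error between \<open>\<Phi> F\<close> and \<open>g\<close> times
    \<open>\<Phi> e\<close> will be at most \<open>5 * \<alpha> + 3 * \<alpha>\<close>, which must
    fit into the room \<open>\<tau> * (1 - \<rho>)\<close>.\<close>
  define \<alpha> where "\<alpha> = \<tau> * (1 - \<rho>) / 8"
  have "\<tau> * (1 - \<rho>) \<le> \<tau>" using \<tau> assms(2) by simp
  moreover have "0 < \<tau> * (1 - \<rho>)" using \<tau>(1) assms(3) by simp
  ultimately have \<alpha>: "0 < \<alpha>" "\<alpha> \<le> \<tau>" "\<alpha> < \<epsilon>" "8 * \<alpha> = \<tau> * (1 - \<rho>)" "8 * \<alpha> \<le> \<tau>"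
    unfolding \<alpha>_def using \<tau> by linarith+
  have "Lip_BPB_for (Lip0 o' :: ('m \<Rightarrow> real) set)"
    using assms(1) by (simp add: Lip_BPB_def)
  from this[unfolded Lip_BPB_for_slope, THEN spec, THEN mp, OF \<alpha>(1)]
  obtain \<eta> where \<eta>: "0 < \<eta>" and scalar:
    "\<forall>f\<in>(Lip0 o' :: ('m \<Rightarrow> real) set). \<forall>p q.
      lip_norm f = 1 \<and> p \<noteq> q \<and> 1 - \<eta> < norm (slope f p q) \<longrightarrow>
      (\<exists>g\<in>Lip0 o'. \<exists>r s. r \<noteq> s \<and> norm (slope g r s) = lip_norm g \<and> lip_norm g = 1 \<and>
        lip_norm (\<lambda>x. g x - f x) < \<alpha> \<and> (dist p r + dist q s) / dist p q < \<alpha>)"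
    by (elim exE conjE) (rule that)
  \<comment> \<open>The loss at \<open>(p, q)\<close> is \<open>\<mu>\<close> for choosing
    \<open>y0\<close> and \<open>\<mu>\<close> for passing to \<open>y1\<close>, whence
    \<open>\<eta>/2\<close>. The bound \<open>1/4\<close> keeps the scalar map nonzero, and
    \<open>\<alpha>\<close> controls the variation over \<open>U\<close>.\<close>
  define \<mu> where "\<mu> = Min {\<alpha>, \<eta>/2, 1/4}"
  have \<mu>: "0 < \<mu>" "\<mu> \<le> \<alpha>" "2 * \<mu> \<le> \<eta>" "\<mu> \<le> 1/4" using \<alpha> \<eta> by (auto simp: \<mu>_def)
  show "\<exists>\<eta>>0. \<forall>F\<in>(Lip0K o' :: ('m \<Rightarrow> 'y) set). \<forall>p q.
      lip_norm F = 1 \<and> p \<noteq> q \<and> 1 - \<eta> < norm (slope F p q) \<longrightarrow>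
      (\<exists>G\<in>Lip0K o'. \<exists>r s. r \<noteq> s \<and> norm (slope G r s) = lip_norm G \<and> lip_norm G = 1 \<and>
        lip_norm (\<lambda>x. G x - F x) < \<epsilon> \<and> (dist p r + dist q s) / dist p q < \<epsilon>)"
  proof (intro exI[of _ \<mu>] conjI ballI allI impI)
    fix F :: "'m \<Rightarrow> 'y" and p q
    assume "F \<in> Lip0K o'" and "lip_norm F = 1 \<and> p \<noteq> q \<and> 1 - \<mu> < norm (slope F p q)"
    then have F1: "lip_norm F = 1" and pq: "p \<noteq> q" and Fpq: "1 - \<mu> < norm (slope F p q)"
      and F: "F \<in> Lip0 o'" and "lipschitz_compact F" by (auto simp: Lip0K_def)
    define K where "K = closure {slope F x y |x y. x \<noteq> y}"
    have K: "compact K"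
      using \<open>lipschitz_compact F\<close> by (simp add: K_def lipschitz_compact_def slope_def)
    have KF: "slope F x y \<in> K" if "x \<noteq> y" for x y
      unfolding K_def by (rule subsetD[OF closure_subset]) (use that in blast)
    have F_le: "norm (slope F x y) \<le> 1" if "x \<noteq> y" for x y
      using Lip0_norm_slope_le[OF F that] F1 by simp
    obtain y0 where y0: "y0 \<in> \<Gamma>" "1 - \<mu> < \<bar>blinfun_apply y0 (slope F p q)\<bar>"
      using one_norming_norm_le[OF \<Gamma>, of "1 - \<mu>" "slope F p q"] Fpq \<mu>(4) by force
    obtain U where U: "openin (subtopology weak_star \<Gamma>) U" "y0 \<in> U" and
      U_close: "\<And>v k. v \<in> U \<Longrightarrow> k \<in> K \<Longrightarrow> \<bar>blinfun_apply v k - blinfun_apply y0 k\<bar> < \<mu>"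
      using weak_star_neighbourhood_compact[OF \<Gamma> y0(1) K \<mu>(1)] by blast
    have "U \<subseteq> \<Gamma>" using openin_imp_subset[OF U(1)] .
    have "U \<noteq> {}" using U(2) by blast
    note ack[THEN spec, THEN mp, OF \<alpha>(1), THEN spec, THEN mp, OF conjI[OF U(1) this]]
    then obtain V y1 e and \<Phi> :: "'y \<Rightarrow>\<^sub>L 'y" where V: "V \<subseteq> U" "y1 \<in> V"
      and e: "norm e = 1" and \<Phi>: "norm \<Phi> = 1"
      and y1e: "blinfun_apply y1 (blinfun_apply \<Phi> e) = 1" and y1\<Phi>: "adjoint_blinfun \<Phi> y1 = y1"
      and V1: "\<forall>v\<in>\<Gamma> - {y \<in> \<Gamma>. norm (adjoint_blinfun \<Phi> y)
                        + (1 - \<alpha>) * norm (y - adjoint_blinfun \<Phi> y) \<le> 1}.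
                 \<bar>blinfun_apply v (blinfun_apply \<Phi> e)\<bar> \<le> \<rho>"
      and aco: "\<And>y. y \<in> \<Gamma> \<Longrightarrow> infdist (adjoint_blinfun \<Phi> y) (aco (insert 0 V)) < \<alpha>"
      and Ve: "\<And>v. v \<in> V \<Longrightarrow> \<bar>blinfun_apply v e - 1\<bar> \<le> \<alpha>"
      unfolding Let_def mem_sphere_0 by (elim exE conjE) (rule that; (assumption | erule (1) bspec))
    have "y1 \<in> \<Gamma>" using V \<open>U \<subseteq> \<Gamma>\<close> by blast

    \<comment> \<open>Scalar approximation of the composed functional\<close>
    define f where "f = (\<lambda>x. blinfun_apply y1 (F x))"
    have f: "f \<in> Lip0 o'"
      unfolding f_def by (rule Lip0_bounded_linear[OF blinfun.bounded_linear_right F])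
    have sf: "slope f x y = blinfun_apply y1 (slope F x y)" for x y
      unfolding f_def by (rule slope_bounded_linear[OF blinfun.bounded_linear_right])
    have f_le: "lip_norm f \<le> 1"
    proof (rule lip_norm_le)
      fix x y :: 'm assume "x \<noteq> y"
      then show "norm (slope f x y) \<le> 1"
        using one_norming_apply_le[OF \<Gamma> \<open>y1 \<in> \<Gamma>\<close>, of "slope F x y"] F_le[of x y] by (simp add: sf)
    qed simp
    have fpq: "1 - 2 * \<mu> < norm (slope f p q)"
      using U_close[OF subsetD[OF V], of "slope F p q"] KF[OF pq] y0(2) by (simp add: sf)
    have f_gt: "1 - 2 * \<mu> < lip_norm f"
      using fpq Lip0_norm_slope_le[OF f pq] by simp
    then have f_pos: "0 < lip_norm f" using \<mu>(4) by simp
    define h where "h = (\<lambda>x. f x /\<^sub>R lip_norm f)"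
    have h: "h \<in> Lip0 o'" "lip_norm h = 1"
      unfolding h_def
      by (rule Lip0_bounded_linear[OF bounded_linear_scaleR_right f],
          rule lip_norm_inverse_scaleR[OF f f_pos])
    have sh: "slope h x y = slope f x y /\<^sub>R lip_norm f" for x y
      unfolding h_def by (rule slope_bounded_linear[OF bounded_linear_scaleR_right])
    \<comment> \<open>Dividing by a norm at most 1 can only enlarge slopes, so the near-attainment
      at \<open>(p, q)\<close> survives normalisation.\<close>
    have "norm (slope f p q) \<le> norm (slope h p q)"
      using f_le f_pos by (simp add: sh field_simps mult_left_le_one_le)
    then have "1 - \<eta> < norm (slope h p q)" using fpq \<mu>(3) by linarith
    with h(2) pq have "lip_norm h = 1 \<and> p \<noteq> q \<and> 1 - \<eta> < norm (slope h p q)" by simp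
    note scalar[THEN bspec, OF h(1), THEN spec, THEN spec, THEN mp, OF this]
    then obtain g r s where g: "g \<in> Lip0 o'" "lip_norm g = 1"
      and rs: "r \<noteq> s" "norm (slope g r s) = 1"
      and gh: "lip_norm (\<lambda>x. g x - h x) < \<alpha>" and dist: "(dist p r + dist q s) / dist p q < \<alpha>"
      by force
    have g_le: "\<bar>slope g x y\<bar> \<le> 1" if "x \<noteq> y" for x y
      using Lip0_norm_slope_le[OF g(1) that] g(2) by simp
    \<comment> \<open>One \<open>\<alpha>\<close> comes from \<open>g\<close> against
      \<open>h\<close>, and \<open>2 * \<mu>\<close> from the normalisation, since
      \<open>lip_norm f\<close> lies between \<open>1 - 2 * \<mu>\<close> and 1.\<close>
    have gf: "\<bar>slope f x y - slope g x y\<bar> \<le> 3 * \<alpha>" if xy: "x \<noteq> y" for x y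
    proof -
      have "(\<lambda>x. g x - h x) \<in> Lip0 o'"
      proof (rule Lip0I)
        show "norm (slope (\<lambda>x. g x - h x) x y) \<le> 2" if "x \<noteq> y" for x y
          using g_le[OF that] Lip0_norm_slope_le[OF h(1) that] h(2) by (simp add: slope_diff)
      qed (use g(1) h(1) in \<open>auto simp: Lip0_def\<close>)
      from Lip0_norm_slope_le[OF this xy] have 1: "\<bar>slope g x y - slope h x y\<bar> < \<alpha>"
        using gh by (simp add: slope_diff)
      have "slope f x y - slope h x y = (lip_norm f - 1) * slope h x y"
        using f_pos by (simp add: sh field_simps)
      moreover have "\<bar>(lip_norm f - 1) * slope h x y\<bar> \<le> (2 * \<mu>) * 1"
        unfolding abs_mult using f_le f_gt Lip0_norm_slope_le[OF h(1) xy] h(2) \<mu>(1)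
        by (intro mult_mono) auto
      ultimately have "\<bar>slope f x y - slope h x y\<bar> \<le> 2 * \<alpha>" using \<mu>(2) by simp
      then show ?thesis using 1 by linarith
    qed
    have close: "norm (blinfun_apply \<Phi> (slope F x y) - slope g x y *\<^sub>R blinfun_apply \<Phi> e) \<le> \<tau> * (1 - \<rho>)"
      if xy: "x \<noteq> y" for x y
      unfolding \<alpha>(4)[symmetric]
    proof (rule one_norming_norm_le[OF \<Gamma>])
      fix v assume v: "v \<in> \<Gamma>"
      \<comment> \<open>Passing from \<open>u\<close> to \<open>y1\<close> through \<open>y0\<close>
        costs \<open>2 * \<mu>\<close>, and from \<open>f\<close> to \<open>g\<close> another
        \<open>3 * \<alpha>\<close>.\<close>
      have Vk: "\<bar>blinfun_apply u (slope F x y) - slope g x y\<bar> \<le> 5 * \<alpha>" if "u \<in> V" for u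
      proof -
        have "u \<in> U" "y1 \<in> U" using that V by auto
        from this[THEN U_close, OF KF[OF xy]] gf[OF xy] \<mu>(2) show ?thesis
          unfolding sf by linarith
      qed
      have "\<bar>blinfun_apply v (blinfun_apply \<Phi> (slope F x y) - slope g x y *\<^sub>R blinfun_apply \<Phi> e)\<bar>
          \<le> 5 * \<alpha> + 3 * \<alpha>"
        by (rule abs_apply_diff_le_infdist_aco[OF _ _ e F_le[OF xy] g_le[OF xy] Vk Ve aco[OF v]])
          (use \<alpha>(1) in auto)
      then show "\<bar>blinfun_apply v (blinfun_apply \<Phi> (slope F x y) - slope g x y *\<^sub>R blinfun_apply \<Phi> e)\<bar>
          \<le> 8 * \<alpha>" by simp
    qed (use \<alpha>(1) in simp)

    \<comment> \<open>The approximating map: norm, compactness, attainment and distance\<close>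
    define G where "G = (\<lambda>x. g x *\<^sub>R blinfun_apply \<Phi> e + (1 - \<tau>) *\<^sub>R (F x - blinfun_apply \<Phi> (F x)))"
    have sG: "slope G x y = slope g x y *\<^sub>R blinfun_apply \<Phi> e
        + (1 - \<tau>) *\<^sub>R (slope F x y - blinfun_apply \<Phi> (slope F x y))" for x y
      unfolding G_def slope_add slope_bounded_linear[OF bounded_linear_scaleR_right]
        slope_bounded_linear[OF bounded_linear_scaleR_left] slope_diff
        slope_bounded_linear[OF blinfun.bounded_linear_right] ..
    have G_le: "norm (slope G x y) \<le> 1" if xy: "x \<noteq> y" for x y
      unfolding sG
    proof (rule norm_ACK_combination_le[OF \<Gamma> assms(2,3) \<alpha>(2) \<tau>(1,2) e F_le[OF xy] g_le[OF xy] _ close[OF xy]])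
      fix v assume "v \<in> \<Gamma>" "\<rho> < \<bar>blinfun_apply v (blinfun_apply \<Phi> e)\<bar>"
      then show "norm (adjoint_blinfun \<Phi> v) + (1 - \<alpha>) * norm (v - adjoint_blinfun \<Phi> v) \<le> 1"
        using V1 by force
    qed
    have G0: "G \<in> Lip0 o'"
      by (rule Lip0I[OF _ G_le]) (use F g(1) in \<open>auto simp: G_def Lip0_def\<close>)
    have "lipschitz_compact G"
    proof -
      \<comment> \<open>A slope of \<open>G\<close> is a continuous function of a slope of
        \<open>g\<close>, which lies in \<open>{-1..1}\<close>, and a slope of \<open>F\<close>,
        which lies in \<open>K\<close>; so all slopes of \<open>G\<close> lie in one compact
        image.\<close>
      let ?T = "\<lambda>z. fst z *\<^sub>R blinfun_apply \<Phi> e + (1 - \<tau>) *\<^sub>R (snd z - blinfun_apply \<Phi> (snd z))"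
      have T: "compact (?T ` ({-1..1} \<times> K))"
        using K by (intro compact_continuous_image compact_Times continuous_intros) auto
      have "{slope G x y |x y. x \<noteq> y} \<subseteq> ?T ` ({-1..1} \<times> K)"
      proof clarify
        fix x y :: 'm assume xy: "x \<noteq> y"
        have "slope G x y = ?T (slope g x y, slope F x y)" by (simp add: sG)
        moreover have "(slope g x y, slope F x y) \<in> {-1..1} \<times> K"
          using g_le[OF xy] KF[OF xy] by auto
        ultimately show "slope G x y \<in> ?T ` ({-1..1} \<times> K)" by (rule image_eqI)
      qed
      then have "closure {slope G x y |x y. x \<noteq> y} \<subseteq> ?T ` ({-1..1} \<times> K)"
        using compact_imp_closed[OF T] by (rule closure_minimal)
      from compact_Int_closed[OF T closed_closure[of "{slope G x y |x y. x \<noteq> y}"],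
          unfolded inf.absorb2[OF this]]
      have "compact (closure {slope G x y |x y. x \<noteq> y})" .
      then show ?thesis by (simp add: lipschitz_compact_def slope_def)
    qed
    then have GK: "G \<in> Lip0K o'" using G0 by (simp add: Lip0K_def)
    \<comment> \<open>Invariance of \<open>y1\<close> under the adjoint makes it vanish on the
      correction term \<open>F - \<Phi> F\<close>, leaving exactly the slope of
      \<open>g\<close>.\<close>
    have "blinfun_apply y1 (blinfun_apply \<Phi> z) = blinfun_apply y1 z" for z
      using arg_cong[OF y1\<Phi>, of "\<lambda>u. blinfun_apply u z"] by (simp add: adjoint_blinfun_def)
    then have "blinfun_apply y1 (slope G r s) = slope g r s"
      using y1e by (simp add: sG blinfun.bilinear_simps)
    then have "1 \<le> norm (slope G r s)"
      using one_norming_apply_le[OF \<Gamma> \<open>y1 \<in> \<Gamma>\<close>, of "slope G r s"] rs(2) by simp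
    then have Grs: "norm (slope G r s) = 1" using G_le[OF rs(1)] by simp
    have G1: "lip_norm G = 1"
      using lip_norm_le[OF _ G_le] Lip0_norm_slope_le[OF G0 rs(1)] Grs by simp
    have "lip_norm (\<lambda>x. G x - F x) \<le> 3 * \<tau>"
    proof (rule lip_norm_le)
      fix x y :: 'm assume xy: "x \<noteq> y"
      let ?k = "slope F x y" and ?D = "blinfun_apply \<Phi> (slope F x y) - slope g x y *\<^sub>R blinfun_apply \<Phi> e"
      \<comment> \<open>The first term is the closeness error, at most \<open>\<tau>\<close>; the
        second is the cost of shrinking by \<open>1 - \<tau>\<close>, at most
        \<open>2 * \<tau>\<close>.\<close>
      have "slope (\<lambda>x. G x - F x) x y = - ?D - \<tau> *\<^sub>R (?k - blinfun_apply \<Phi> ?k)"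
        by (simp add: slope_diff sG algebra_simps)
      then have "norm (slope (\<lambda>x. G x - F x) x y) \<le> norm ?D + \<tau> * norm (?k - blinfun_apply \<Phi> ?k)"
        using norm_triangle_ineq4[of "- ?D" "\<tau> *\<^sub>R (?k - blinfun_apply \<Phi> ?k)"] \<tau>(1)
        by (simp add: norm_minus_commute)
      also have "\<dots> \<le> \<tau> + \<tau> * 2"
      proof (intro add_mono mult_left_mono)
        show "norm ?D \<le> \<tau>" using close[OF xy] \<alpha>(4,5) by simp
        have "norm (blinfun_apply \<Phi> ?k) \<le> 1"
          using norm_blinfun[of \<Phi> ?k] \<Phi> F_le[OF xy] by simp
        then show "norm (?k - blinfun_apply \<Phi> ?k) \<le> 2"
          using norm_triangle_ineq4[of ?k "blinfun_apply \<Phi> ?k"] F_le[OF xy] by simp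
      qed (use \<tau>(1) in simp)
      finally show "norm (slope (\<lambda>x. G x - F x) x y) \<le> 3 * \<tau>" by simp
    qed (use \<tau>(1) in simp)
    then have "lip_norm (\<lambda>x. G x - F x) < \<epsilon>" using \<tau>(3) by linarith
    moreover have "(dist p r + dist q s) / dist p q < \<epsilon>" using dist \<alpha>(3) by linarith
    ultimately show "\<exists>G\<in>Lip0K o'. \<exists>r s. r \<noteq> s \<and> norm (slope G r s) = lip_norm G \<and> lip_norm G = 1 \<and>
        lip_norm (\<lambda>x. G x - F x) < \<epsilon> \<and> (dist p r + dist q s) / dist p q < \<epsilon>"
      using GK rs(1) Grs G1 by (intro bexI[of _ G] exI[of _ r] exI[of _ s]) auto
  qed (rule \<mu>(1))
qed

end
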